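(* (i) If the Bayesian predictor $p_0(X)$ satisfies $$\mathbb{E}\big(p_0(X)-m(X,\mathbb{T})\big)^2=0,\qquad ( * )$$ then $p_0(X)$ is unbiased for predicting $Y$, i.e. $\mathbb{E}(p_0(X)\mid\mathbb{T})=\mathbb{E}(Y\mid\mathbb{T})$. (ii) Conversely, suppose that $\mathbb{Q}$ admits a strictly positive density $f(x,y,\theta)\varphi(\theta)$ over $F\times G\times\Theta$ with respect to the $\sigma$-finite measure $\lambda\otimes\mu\otimes\nu$, with $f$ and $\varphi$ continuous with respect to $\theta$ on $\Theta$. If $$m(X,\theta)=A(X)+D(\theta),\qquad\theta\in\Theta,$$ where $A$ and $D$ (regarded as functions of $(x,\theta)$) belong to $L^2(\mathbb{Q}_{(X,\mathbb{T})})$, and if $p_0(X)$ is unbiased for predicting $Y$, then $( * )$ holds.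
   Context: $(X,Y)$ is a random vector with values in $(F\times G,\mathcal{F}\otimes\mathcal{G})$, where $F$, $G$ are $\mathbb{N}$ or $\mathbb{R}^k$, and $Y$ is real valued and square integrable. Its distribution belongs to a family $(\mathbb{P}_\theta,\theta\in\Theta)$, where $\Theta\subset\mathbb{R}$ is open and $\mathbb{P}_\theta$ has density $f(x,y,\theta)$ with respect to a $\sigma$-finite measure $\lambda\otimes\mu$. A random variable $\mathbb{T}$ with values in $\Theta$ has prior density $\varphi$ with respect to a $\sigma$-finite measure $\nu$. $\mathbb{Q}$ is the joint law of $(X,Y,\mathbb{T})$, with density $f(x,y,\theta)\varphi(\theta)$, and $\mathbb{Q}_{(X,\mathbb{T})}$ is the law of $(X,\mathbb{T})$. $\mathbb{E}_\theta$ refers to $\mathbb{P}_\theta$ and $\mathbb{E}$ to $\mathbb{Q}$. Set $$m(X,\theta)=\mathbb{E}_\theta(Y\mid X)=\frac{\int_G y f(X,y,\theta)\,d\mu(y)}{\int_G f(X,y,\theta)\,d\mu(y)},$$ so that $m(X,\mathbb{T})=\mathbb{E}(Y\mid X,\mathbb{T})$. The Bayesian predictor is $p_0(X)=\arg\min_p\mathbb{E}(p(X)-Y)^2=\mathbb{E}(Y\mid X)$, assumed to exist. A predictor $p(X)$ of $Y$ is unbiased if $\mathbb{E}_\theta\,p(X)=\mathbb{E}_\theta(Y)$ for $\theta\in\Theta$. In the Bayesian interpretation, used here, this means $\mathbb{E}(p(X)\mid\mathbb{T}=\theta)=\mathbb{E}(Y\mid\mathbb{T}=\theta)$, i.e.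 $\mathbb{E}(p(X)\mid\mathbb{T})=\mathbb{E}(Y\mid\mathbb{T})$ $\mathbb{Q}$-almost surely. *)

theory Defs
  imports "HOL-Probability.Probability"
begin

text \<open>
  \<open>nat_or_Rk S\<close>: the set \<open>S\<close> is the whole space \<open>R^k\<close> (\<open>k = DIM('a)\<close>), or it is the set of natural
  numbers inside the line (then \<open>DIM('a) = 1\<close> and \<open>b\<close> is its unit vector).  In the second case the
  trace of the Borel sets on \<open>S\<close> consists of all subsets of \<open>S\<close>.
\<close>

definition nat_or_Rk :: "'a::euclidean_space set \<Rightarrow> bool" where
  "nat_or_Rk S \<longleftrightarrow> S = UNIV \<or> (\<exists>b. Basis = {b} \<and> S = range (\<lambda>n::nat. real n *\<^sub>R b))"

lemma nat_or_Rk_real: "nat_or_Rk (S::real set) \<longleftrightarrow> S = UNIV \<or> S = \<nat>"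
  by (auto simp: nat_or_Rk_def Nats_def)

text \<open>
  Everything lives on the canonical space: under \<open>P_law\<close> the pair \<open>(X, Y)\<close>, and under \<open>Q_law\<close> the
  triple \<open>(X, Y, T)\<close>, consists of the coordinate maps, so that these measures are the laws themselves.
\<close>

definition P_law ::
  "'a measure \<Rightarrow> real measure \<Rightarrow> ('a \<Rightarrow> real \<Rightarrow> real \<Rightarrow> real) \<Rightarrow> real \<Rightarrow> ('a \<times> real) measure" where
  "P_law lam mu f \<theta> = density (lam \<Otimes>\<^sub>M mu) (\<lambda>(x, y). ennreal (f x y \<theta>))"

definition Q_law ::
  "'a measure \<Rightarrow> real measure \<Rightarrow> real measure \<Rightarrow> ('a \<Rightarrow> real \<Rightarrow> real \<Rightarrow> real) \<Rightarrow> (real \<Rightarrow> real)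
    \<Rightarrow> ('a \<times> real \<times> real) measure" where
  "Q_law lam mu nu f \<phi> =
     density (lam \<Otimes>\<^sub>M mu \<Otimes>\<^sub>M nu) (\<lambda>(x, y, \<theta>). ennreal (f x y \<theta> * \<phi> \<theta>))"

abbreviation X_rv :: "'a \<times> real \<times> real \<Rightarrow> 'a" where "X_rv \<equiv> \<lambda>(x, y, \<theta>). x"
abbreviation Y_rv :: "'a \<times> real \<times> real \<Rightarrow> real" where "Y_rv \<equiv> \<lambda>(x, y, \<theta>). y"
abbreviation T_rv :: "'a \<times> real \<times> real \<Rightarrow> real" where "T_rv \<equiv> \<lambda>(x, y, \<theta>). \<theta>"

definition square_integrable :: "'b measure \<Rightarrow> ('b \<Rightarrow> real) \<Rightarrow> bool" where
  "square_integrable M g \<longleftrightarrow> g \<in> borel_measurable M \<and> integrable M (\<lambda>z. (g z)\<^sup>2)"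

locale bayesian_prediction_model =
  fixes F :: "'a::euclidean_space set" and G :: "real set" and \<Theta> :: "real set"
    and lam :: "'a measure" and mu :: "real measure" and nu :: "real measure"
    and f :: "'a \<Rightarrow> real \<Rightarrow> real \<Rightarrow> real" and \<phi> :: "real \<Rightarrow> real"
  assumes F: "nat_or_Rk F" and G: "nat_or_Rk G" and open_Theta: "open \<Theta>"
    and lam: "sigma_finite_measure lam" "sets lam = sets (restrict_space borel F)"
    and mu: "sigma_finite_measure mu" "sets mu = sets (restrict_space borel G)"
    and nu: "sigma_finite_measure nu" "sets nu = sets (restrict_space borel \<Theta>)"
    and f_measurable: "(\<lambda>(x, y, \<theta>). f x y \<theta>) \<in> borel_measurable (lam \<Otimes>\<^sub>M mu \<Otimes>\<^sub>M nu)"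
    and f_nonneg: "\<And>x y \<theta>. x \<in> F \<Longrightarrow> y \<in> G \<Longrightarrow> \<theta> \<in> \<Theta> \<Longrightarrow> 0 \<le> f x y \<theta>"
    and prob_P: "\<And>\<theta>. \<theta> \<in> \<Theta> \<Longrightarrow> prob_space (P_law lam mu f \<theta>)"
    and phi_measurable: "\<phi> \<in> borel_measurable nu"
    and phi_nonneg: "\<And>\<theta>. \<theta> \<in> \<Theta> \<Longrightarrow> 0 \<le> \<phi> \<theta>"
    and prob_prior: "prob_space (density nu (\<lambda>\<theta>. ennreal (\<phi> \<theta>)))"
    and Y_square_integrable_P: "\<And>\<theta>. \<theta> \<in> \<Theta> \<Longrightarrow> square_integrable (P_law lam mu f \<theta>) (\<lambda>(x, y). y)"
    and Y_square_integrable_Q: "square_integrable (Q_law lam mu nu f \<phi>) Y_rv"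

definition Q_XT_law ::
  "'a measure \<Rightarrow> real measure \<Rightarrow> real measure \<Rightarrow> ('a \<Rightarrow> real \<Rightarrow> real \<Rightarrow> real) \<Rightarrow> (real \<Rightarrow> real)
    \<Rightarrow> ('a \<times> real) measure" where
  "Q_XT_law lam mu nu f \<phi> =
     distr (Q_law lam mu nu f \<phi>) (lam \<Otimes>\<^sub>M nu) (\<lambda>(x, y, \<theta>). (x, \<theta>))"

definition cond_mean :: "real measure \<Rightarrow> ('a \<Rightarrow> real \<Rightarrow> real \<Rightarrow> real) \<Rightarrow> 'a \<Rightarrow> real \<Rightarrow> real" where
  "cond_mean mu f x \<theta> = (\<integral>y. y * f x y \<theta> \<partial>mu) / (\<integral>y. f x y \<theta> \<partial>mu)"

text \<open>
  Mean squares are taken in \<open>[0, \<infinity>]\<close>, hence the minimum below is over all measurable functions of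
  \<open>X\<close>; as \<open>Y\<close> is square integrable, the minimal value is finite.
\<close>

definition bayesian_predictor ::
  "'a measure \<Rightarrow> real measure \<Rightarrow> real measure \<Rightarrow> ('a \<Rightarrow> real \<Rightarrow> real \<Rightarrow> real) \<Rightarrow> (real \<Rightarrow> real)
    \<Rightarrow> ('a \<Rightarrow> real) \<Rightarrow> bool" where
  "bayesian_predictor lam mu nu f \<phi> p0 \<longleftrightarrow>
     is_arg_min (\<lambda>p. \<integral>\<^sup>+(x, y, \<theta>). ennreal ((p x - y)\<^sup>2) \<partial>Q_law lam mu nu f \<phi>)
       (\<lambda>p. p \<in> borel_measurable lam) p0"

text \<open>
  Conditional expectations given \<open>T\<close> are taken with respect to the sigma-algebra generated by \<open>T\<close>.
\<close>

definition unbiased_predictor ::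
  "'a measure \<Rightarrow> real measure \<Rightarrow> real measure \<Rightarrow> ('a \<Rightarrow> real \<Rightarrow> real \<Rightarrow> real) \<Rightarrow> (real \<Rightarrow> real)
    \<Rightarrow> ('a \<Rightarrow> real) \<Rightarrow> bool" where
  "unbiased_predictor lam mu nu f \<phi> p \<longleftrightarrow>
     (let Q = Q_law lam mu nu f \<phi>; sigma_T = vimage_algebra (space Q) T_rv nu in
      p \<in> borel_measurable lam \<and> integrable Q (\<lambda>\<omega>. p (X_rv \<omega>)) \<and>
      (AE \<omega> in Q. real_cond_exp Q sigma_T (\<lambda>\<omega>. p (X_rv \<omega>)) \<omega> = real_cond_exp Q sigma_T Y_rv \<omega>))"

end

theory Submission
  imports Defs
begin

text \<open>
  The proof is Hilbert space geometry in \<open>L\<^sup>2(Q)\<close>. Three orthogonality relations describe the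
  objects involved: \<open>p\<^sub>0(X)\<close>, a minimiser of the quadratic risk, has the same inner product as \<open>Y\<close>
  with every square integrable function of \<open>X\<close> (\<open>bayesian_predictor_orthogonal\<close>); \<open>m(X,T)\<close>, and
  hence any function almost surely equal to it, has the same inner product as \<open>Y\<close> with functions
  of \<open>(X,T)\<close> (\<open>integral_mult_eq_if_eq_cond_mean\<close>); and \<open>p\<^sub>0(X)\<close> is unbiased when it has the same
  inner product as \<open>Y\<close> with functions of \<open>T\<close> (\<open>unbiased_of_set_integrals\<close>, with the converse in
  \<open>unbiased_integral_eq\<close>).

  For the first claim, if \<open>p\<^sub>0(X) = m(X,T)\<close> almost surely, then the second relation, tested against
  indicators of events in the sigma-algebra of \<open>T\<close>, is the third one.

  For the converse, let \<open>m(X,T) = A(X) + D(T)\<close> and \<open>B = p\<^sub>0 - A\<close>. Testing \<open>p\<^sub>0(X)\<close>, \<open>Y\<close> and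
  \<open>A(X) + D(T)\<close> against \<open>B(X)\<close> gives \<open>E B\<^sup>2 = E B D\<close>, because \<open>p\<^sub>0\<close> is the Bayesian predictor; testing
  them against \<open>D(T)\<close> gives \<open>E D\<^sup>2 = E B D\<close>, because \<open>p\<^sub>0\<close> is unbiased. Hence \<open>E (B - D)\<^sup>2 = 0\<close>, so
  \<open>B(X) = D(T)\<close> and \<open>p\<^sub>0(X) = A(X) + D(T) = m(X,T)\<close> almost surely. In words: two conditional
  expectations, of \<open>D(T)\<close> given \<open>X\<close> and of the result given \<open>T\<close>, return \<open>D(T)\<close>; as each is a
  contraction, neither loses any norm, so the first already fixes \<open>D(T)\<close>.
\<close>

section \<open>Square integrable functions\<close>

lemma square_integrable_imp_integrable_mult:
  assumes "square_integrable M u" "square_integrable M v"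
  shows "integrable M (\<lambda>z. u z * v z)"
proof (rule Bochner_Integration.integrable_bound)
  show "integrable M (\<lambda>z. (u z)\<^sup>2 + (v z)\<^sup>2)"
    using assms by (auto simp: square_integrable_def)
  show "(\<lambda>z. u z * v z) \<in> borel_measurable M"
    using assms by (auto simp: square_integrable_def)
  show "AE z in M. norm (u z * v z) \<le> norm ((u z)\<^sup>2 + (v z)\<^sup>2)"
  proof (rule AE_I2)
    fix z
    have "2 * (\<bar>u z\<bar> * \<bar>v z\<bar>) \<le> (u z)\<^sup>2 + (v z)\<^sup>2"
      using sum_squares_bound[of "\<bar>u z\<bar>" "\<bar>v z\<bar>"] by (simp add: mult.assoc)
    moreover have "0 \<le> \<bar>u z\<bar> * \<bar>v z\<bar>" by simp
    ultimately have "\<bar>u z\<bar> * \<bar>v z\<bar> \<le> (u z)\<^sup>2 + (v z)\<^sup>2" by linarith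
    then show "norm (u z * v z) \<le> norm ((u z)\<^sup>2 + (v z)\<^sup>2)"
      by (simp add: abs_mult)
  qed
qed

lemma square_integrable_add:
  assumes u: "square_integrable M u" and v: "square_integrable M v"
  shows "square_integrable M (\<lambda>z. u z + v z)"
proof -
  have "integrable M (\<lambda>z. (u z)\<^sup>2 + (v z)\<^sup>2 + 2 * (u z * v z))"
    using u v square_integrable_imp_integrable_mult[OF u v]
    by (auto simp: square_integrable_def)
  then show ?thesis
    using u v by (auto simp: square_integrable_def power2_sum mult.assoc)
qed

lemma square_integrable_cmult:
  assumes u: "square_integrable M u"
  shows "square_integrable M (\<lambda>z. c * u z)"
  using u by (auto simp: square_integrable_def power_mult_distrib)

lemma square_integrable_diff:
  assumes u: "square_integrable M u" and v: "square_integrable M v"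
  shows "square_integrable M (\<lambda>z. u z - v z)"
  using square_integrable_add[OF u square_integrable_cmult[OF v, of "-1"]] by simp

lemma (in finite_measure) square_integrable_const: "square_integrable M (\<lambda>_. c)"
  by (simp add: square_integrable_def)

lemma (in finite_measure) square_integrable_imp_integrable:
  assumes "square_integrable M u" shows "integrable M u"
  using square_integrable_imp_integrable_mult[OF assms square_integrable_const[of 1]] by simp

text \<open>
  The hypotheses say that \<open>u - v\<close> is orthogonal to \<open>u\<close> and to \<open>v\<close>, hence to itself.
\<close>

lemma AE_eq_of_norms_eq_inner:
  assumes u: "square_integrable M u" and v: "square_integrable M v"
    and uu: "(\<integral>z. (u z)\<^sup>2 \<partial>M) = (\<integral>z. u z * v z \<partial>M)"
    and vv: "(\<integral>z. (v z)\<^sup>2 \<partial>M) = (\<integral>z. u z * v z \<partial>M)"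
  shows "AE z in M. u z = v z"
proof -
  have uv: "integrable M (\<lambda>z. u z * v z)"
    by (rule square_integrable_imp_integrable_mult[OF u v])
  have "(\<integral>z. (u z - v z)\<^sup>2 \<partial>M) = (\<integral>z. (u z)\<^sup>2 + (v z)\<^sup>2 - 2 * (u z * v z) \<partial>M)"
    by (simp add: power2_diff mult.assoc)
  also have "\<dots> = 0"
    using u v uv uu vv by (simp add: square_integrable_def)
  finally have "(\<integral>z. (u z - v z)\<^sup>2 \<partial>M) = 0" .
  moreover have "integrable M (\<lambda>z. (u z - v z)\<^sup>2)"
    using square_integrable_diff[OF u v] by (simp add: square_integrable_def)
  ultimately have "AE z in M. (u z - v z)\<^sup>2 = 0"
    by (subst (asm) integral_nonneg_eq_0_iff_AE) auto
  then show ?thesis by eventually_elim simp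
qed

text \<open>
  The derivative of \<open>t \<mapsto> \<integral>(r + t g)\<^sup>2\<close> vanishes at the minimum \<open>t = 0\<close>; the proof evaluates this
  quadratic polynomial at one well chosen point.
\<close>

lemma least_squares_orthogonal:
  assumes r: "square_integrable M r" and g: "square_integrable M g"
    and min: "\<And>t. (\<integral>z. (r z)\<^sup>2 \<partial>M) \<le> (\<integral>z. (r z + t * g z)\<^sup>2 \<partial>M)"
  shows "(\<integral>z. r z * g z \<partial>M) = 0"
proof -
  define c where "c = (\<integral>z. r z * g z \<partial>M)"
  define s where "s = (\<integral>z. (g z)\<^sup>2 \<partial>M)"
  have s: "0 \<le> s" by (simp add: s_def)
  have rg: "integrable M (\<lambda>z. r z * g z)"
    by (rule square_integrable_imp_integrable_mult[OF r g])
  have "0 \<le> t\<^sup>2 * s + 2 * t * c" for t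
  proof -
    have "(\<integral>z. (r z + t * g z)\<^sup>2 \<partial>M)
        = (\<integral>z. (r z)\<^sup>2 + (t\<^sup>2 * (g z)\<^sup>2 + 2 * t * (r z * g z)) \<partial>M)"
      by (rule Bochner_Integration.integral_cong) (auto simp: power2_eq_square algebra_simps)
    also have "\<dots> = (\<integral>z. (r z)\<^sup>2 \<partial>M) + (t\<^sup>2 * s + 2 * t * c)"
      using r g rg unfolding square_integrable_def s_def c_def by simp
    finally show ?thesis using min[of t] by linarith
  qed
  \<comment> \<open>The minimum of the parabola is at \<open>- c / s\<close>; the shift by one avoids the case \<open>s = 0\<close>.\<close>
  from this[of "- c / (s + 1)"]
  have "0 \<le> (- c / (s + 1))\<^sup>2 * s + 2 * (- c / (s + 1)) * c" .
  also have "\<dots> = - (c\<^sup>2 * (s + 2)) / (s + 1)\<^sup>2"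
    using s by (simp add: field_simps power2_eq_square add_nonneg_eq_0_iff)
  finally have "c\<^sup>2 * (s + 2) \<le> 0"
    using s by (simp add: zero_le_divide_iff divide_le_0_iff split: if_splits)
  then have "c\<^sup>2 \<le> 0" using s by (simp add: mult_le_0_iff)
  then show ?thesis by (simp add: c_def)
qed

section \<open>Reordering triple products\<close>

text \<open>
  The coordinates of the model come in the order \<open>(x, y, \<theta>)\<close>, but conditioning on \<open>(X, T)\<close> means
  integrating over \<open>y\<close> first. Moving the middle factor to the end makes Fubini's theorem for two
  factors applicable.
\<close>

lemma distr_pair_rotate:
  assumes "sigma_finite_measure M" "sigma_finite_measure N" "sigma_finite_measure K"
  shows "distr ((M \<Otimes>\<^sub>M K) \<Otimes>\<^sub>M N) (M \<Otimes>\<^sub>M N \<Otimes>\<^sub>M K) (\<lambda>w. (fst (fst w), snd w, snd (fst w))) = M \<Otimes>\<^sub>M N \<Otimes>\<^sub>M K"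
    (is "distr ?S ?T ?r = _")
proof (rule measure_eqI)
  interpret M: sigma_finite_measure M by fact
  interpret N: sigma_finite_measure N by fact
  interpret K: sigma_finite_measure K by fact
  interpret NK: pair_sigma_finite N K ..
  have r: "?r \<in> measurable ?S ?T" by measurable
  fix A assume "A \<in> sets (distr ?S ?T ?r)"
  then have A[measurable]: "A \<in> sets ?T" by simp
  have "emeasure (distr ?S ?T ?r) A = (\<integral>\<^sup>+w. indicator A (?r w) \<partial>?S)"
    using nn_integral_distr[OF r, of "indicator A"] by simp
  also have "\<dots> = (\<integral>\<^sup>+q. (\<integral>\<^sup>+y. indicator A (fst q, y, snd q) \<partial>N) \<partial>(M \<Otimes>\<^sub>M K))"
    by (subst N.nn_integral_fst[symmetric]) auto
  also have "\<dots> = (\<integral>\<^sup>+x. (\<integral>\<^sup>+z. (\<integral>\<^sup>+y. indicator A (x, y, z) \<partial>N) \<partial>K) \<partial>M)"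
    by (subst K.nn_integral_fst[symmetric]) auto
  also have "\<dots> = (\<integral>\<^sup>+x. (\<integral>\<^sup>+y. (\<integral>\<^sup>+z. indicator A (x, y, z) \<partial>K) \<partial>N) \<partial>M)"
    by (intro nn_integral_cong NK.Fubini') measurable
  also have "\<dots> = (\<integral>\<^sup>+x. (\<integral>\<^sup>+w. indicator A (x, w) \<partial>(N \<Otimes>\<^sub>M K)) \<partial>M)"
    by (intro nn_integral_cong, subst K.nn_integral_fst[symmetric]) auto
  also have "\<dots> = (\<integral>\<^sup>+w. indicator A w \<partial>?T)"
    by (subst NK.P.nn_integral_fst) auto
  finally show "emeasure (distr ?S ?T ?r) A = emeasure ?T A" by simp
qed simp

text \<open>
  This order of integration is the one in which the joint law is a mixture over \<open>\<theta>\<close> of the laws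
  of \<open>(X, Y)\<close>.
\<close>

lemma nn_integral_pair_last_outermost:
  assumes "sigma_finite_measure M" "sigma_finite_measure N" "sigma_finite_measure K"
    and h[measurable]: "h \<in> borel_measurable (M \<Otimes>\<^sub>M N \<Otimes>\<^sub>M K)"
  shows "(\<integral>\<^sup>+w. h w \<partial>(M \<Otimes>\<^sub>M N \<Otimes>\<^sub>M K)) = (\<integral>\<^sup>+z. (\<integral>\<^sup>+(x, y). h (x, y, z) \<partial>(M \<Otimes>\<^sub>M N)) \<partial>K)"
proof -
  interpret M: sigma_finite_measure M by fact
  interpret N: sigma_finite_measure N by fact
  interpret K: sigma_finite_measure K by fact
  interpret MK: pair_sigma_finite M K ..
  have "(\<integral>\<^sup>+w. h w \<partial>(M \<Otimes>\<^sub>M N \<Otimes>\<^sub>M K))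
      = (\<integral>\<^sup>+q. h (fst (fst q), snd q, snd (fst q)) \<partial>((M \<Otimes>\<^sub>M K) \<Otimes>\<^sub>M N))"
    by (subst distr_pair_rotate[OF assms(1-3), symmetric], subst nn_integral_distr)
      (auto simp: case_prod_beta)
  also have "\<dots> = (\<integral>\<^sup>+p. (\<integral>\<^sup>+y. h (fst p, y, snd p) \<partial>N) \<partial>(M \<Otimes>\<^sub>M K))"
    by (subst N.nn_integral_fst[symmetric]) auto
  also have "\<dots> = (\<integral>\<^sup>+z. (\<integral>\<^sup>+x. (\<integral>\<^sup>+y. h (x, y, z) \<partial>N) \<partial>M) \<partial>K)"
    by (subst MK.nn_integral_snd[symmetric]) auto
  also have "\<dots> = (\<integral>\<^sup>+z. (\<integral>\<^sup>+(x, y). h (x, y, z) \<partial>(M \<Otimes>\<^sub>M N)) \<partial>K)"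
    by (intro nn_integral_cong, subst N.nn_integral_fst[symmetric]) (auto simp: case_prod_beta)
  finally show ?thesis .
qed

section \<open>The joint law as a mixture over the prior\<close>

context bayesian_prediction_model
begin

abbreviation "Q \<equiv> Q_law lam mu nu f \<phi>"
abbreviation "m \<equiv> cond_mean mu f"

sublocale L: sigma_finite_measure lam by (rule lam)
sublocale U: sigma_finite_measure mu by (rule mu)
sublocale V: sigma_finite_measure nu by (rule nu)

lemma spaces: "space lam = F" "space mu = G" "space nu = \<Theta>"
  using sets_eq_imp_space_eq[OF lam(2)] sets_eq_imp_space_eq[OF mu(2)]
    sets_eq_imp_space_eq[OF nu(2)] by (auto simp: space_restrict_space)

lemma id_measurable_mu[measurable]: "(\<lambda>y. y) \<in> borel_measurable mu"
  by (subst measurable_cong_sets[OF mu(2) refl]) (auto intro: measurable_restrict_space1)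

lemma sets_Q[measurable_cong, simp]: "sets Q = sets (lam \<Otimes>\<^sub>M mu \<Otimes>\<^sub>M nu)"
  by (simp add: Q_law_def)

lemma space_Q: "space Q = F \<times> G \<times> \<Theta>"
  by (simp add: Q_law_def space_pair_measure spaces)

declare phi_measurable[measurable]

lemma f_measurable_comp[measurable (raw)]:
  assumes [measurable]: "a \<in> measurable M lam" "b \<in> measurable M mu" "c \<in> measurable M nu"
  shows "(\<lambda>w. f (a w) (b w) (c w)) \<in> borel_measurable M"
proof -
  have "(\<lambda>w. (\<lambda>(x, y, \<theta>). f x y \<theta>) (a w, b w, c w)) \<in> borel_measurable M"
    by (rule measurable_compose[OF _ f_measurable]) measurable
  then show ?thesis by simp
qed

lemma m_measurable[measurable]: "(\<lambda>(x, \<theta>). m x \<theta>) \<in> borel_measurable (lam \<Otimes>\<^sub>M nu)"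
  unfolding cond_mean_def by measurable

lemma Q_nn_integral_disintegrate:
  assumes h[measurable]: "h \<in> borel_measurable (lam \<Otimes>\<^sub>M mu \<Otimes>\<^sub>M nu)"
  shows "(\<integral>\<^sup>+w. h w \<partial>Q) = (\<integral>\<^sup>+\<theta>. ennreal (\<phi> \<theta>) * (\<integral>\<^sup>+(x, y). h (x, y, \<theta>) \<partial>P_law lam mu f \<theta>) \<partial>nu)"
proof -
  have "(\<integral>\<^sup>+w. h w \<partial>Q)
      = (\<integral>\<^sup>+(x, y, \<theta>). ennreal (f x y \<theta> * \<phi> \<theta>) * h (x, y, \<theta>) \<partial>(lam \<Otimes>\<^sub>M mu \<Otimes>\<^sub>M nu))"
    unfolding Q_law_def by (subst nn_integral_density) (auto simp: case_prod_beta')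
  also have "\<dots> = (\<integral>\<^sup>+\<theta>. (\<integral>\<^sup>+(x, y). ennreal (f x y \<theta> * \<phi> \<theta>) * h (x, y, \<theta>) \<partial>(lam \<Otimes>\<^sub>M mu)) \<partial>nu)"
    by (subst nn_integral_pair_last_outermost) (auto intro: lam mu nu)
  also have "\<dots> = (\<integral>\<^sup>+\<theta>. ennreal (\<phi> \<theta>) * (\<integral>\<^sup>+(x, y). h (x, y, \<theta>) \<partial>P_law lam mu f \<theta>) \<partial>nu)"
  proof (rule nn_integral_cong)
    fix \<theta> assume \<theta>[measurable, simp]: "\<theta> \<in> space nu"
    have "(\<integral>\<^sup>+(x, y). ennreal (f x y \<theta> * \<phi> \<theta>) * h (x, y, \<theta>) \<partial>(lam \<Otimes>\<^sub>M mu))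
        = (\<integral>\<^sup>+(x, y). ennreal (\<phi> \<theta>) * (ennreal (f x y \<theta>) * h (x, y, \<theta>)) \<partial>(lam \<Otimes>\<^sub>M mu))"
      using \<theta> f_nonneg phi_nonneg
      by (intro nn_integral_cong)
        (auto simp: space_pair_measure spaces ennreal_mult'' mult_ac)
    also have "\<dots> = ennreal (\<phi> \<theta>) * (\<integral>\<^sup>+(x, y). ennreal (f x y \<theta>) * h (x, y, \<theta>) \<partial>(lam \<Otimes>\<^sub>M mu))"
      by (subst nn_integral_cmult[symmetric]) (auto simp: case_prod_beta')
    also have "(\<integral>\<^sup>+(x, y). ennreal (f x y \<theta>) * h (x, y, \<theta>) \<partial>(lam \<Otimes>\<^sub>M mu))
        = (\<integral>\<^sup>+(x, y). h (x, y, \<theta>) \<partial>P_law lam mu f \<theta>)"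
      unfolding P_law_def by (subst nn_integral_density) (auto simp: case_prod_beta')
    finally show "(\<integral>\<^sup>+(x, y). ennreal (f x y \<theta> * \<phi> \<theta>) * h (x, y, \<theta>) \<partial>(lam \<Otimes>\<^sub>M mu))
        = ennreal (\<phi> \<theta>) * (\<integral>\<^sup>+(x, y). h (x, y, \<theta>) \<partial>P_law lam mu f \<theta>)" .
  qed
  finally show ?thesis .
qed

sublocale Q: prob_space Q
proof
  have "(\<integral>\<^sup>+w. 1 \<partial>Q) = (\<integral>\<^sup>+\<theta>. ennreal (\<phi> \<theta>) \<partial>nu)"
    using prob_space.emeasure_space_1[OF prob_P]
    by (subst Q_nn_integral_disintegrate) (auto intro!: nn_integral_cong simp: spaces case_prod_beta')
  also have "\<dots> = (\<integral>\<^sup>+\<theta>. 1 \<partial>density nu (\<lambda>\<theta>. ennreal (\<phi> \<theta>)))"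
    by (subst nn_integral_density) auto
  also have "\<dots> = 1" using prob_space.emeasure_space_1[OF prob_prior] by simp
  finally show "emeasure Q (space Q) = 1" by simp
qed

text \<open>
  Carries a property from the individual laws of \<open>(X, Y)\<close> to the joint law. The exceptional set must
  be measurable jointly in \<open>(x, y, \<theta>)\<close>: it is given only as a family of null sets, one for each of
  uncountably many \<open>\<theta>\<close>.
\<close>

lemma AE_Q_of_AE_P:
  assumes [measurable]: "{w \<in> space (lam \<Otimes>\<^sub>M mu \<Otimes>\<^sub>M nu). \<not> R w} \<in> sets (lam \<Otimes>\<^sub>M mu \<Otimes>\<^sub>M nu)"
    and AE: "\<And>\<theta>. \<theta> \<in> \<Theta> \<Longrightarrow> AE (x, y) in P_law lam mu f \<theta>. R (x, y, \<theta>)"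
  shows "AE w in Q. R w"
proof -
  let ?N = "{w \<in> space (lam \<Otimes>\<^sub>M mu \<Otimes>\<^sub>M nu). \<not> R w}"
  have "emeasure Q ?N = (\<integral>\<^sup>+w. indicator ?N w \<partial>Q)" by simp
  also have "\<dots> = (\<integral>\<^sup>+\<theta>. ennreal (\<phi> \<theta>) * (\<integral>\<^sup>+(x, y). indicator ?N (x, y, \<theta>) \<partial>P_law lam mu f \<theta>) \<partial>nu)"
    by (rule Q_nn_integral_disintegrate) measurable
  also have "\<dots> = (\<integral>\<^sup>+\<theta>. 0 \<partial>nu)"
  proof (rule nn_integral_cong)
    fix \<theta> assume "\<theta> \<in> space nu"
    then have "AE (x, y) in P_law lam mu f \<theta>. R (x, y, \<theta>)" using AE by (simp add: spaces)
    then have "(\<integral>\<^sup>+(x, y). indicator ?N (x, y, \<theta>) \<partial>P_law lam mu f \<theta>)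
        = (\<integral>\<^sup>+_. (0::ennreal) \<partial>P_law lam mu f \<theta>)"
      by (intro nn_integral_cong_AE) (auto elim!: eventually_mono)
    then show "ennreal (\<phi> \<theta>) * (\<integral>\<^sup>+(x, y). indicator ?N (x, y, \<theta>) \<partial>P_law lam mu f \<theta>) = 0"
      by simp
  qed
  finally have "emeasure Q ?N = 0" by simp
  then show ?thesis
    by (subst AE_iff_measurable[OF _ refl]) (auto simp: Q_law_def)
qed

section \<open>The regression function as a conditional expectation\<close>

text \<open>
  The weak form of \<open>m(X,T) = E(Y | X,T)\<close>. For fixed \<open>(x, \<theta>)\<close> the inner integral over \<open>y\<close> of
  \<open>(y - m(x,\<theta>)) f(x,y,\<theta>)\<close> vanishes by the quotient formula for \<open>m\<close>. Where the denominator of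
  \<open>m\<close> is zero, the density vanishes for almost every \<open>y\<close> and so does the numerator. Where
  \<open>\<phi>(\<theta>) = 0\<close> the weight kills the integrand; elsewhere the integrals over \<open>y\<close> converge almost
  everywhere because \<open>1\<close> and \<open>Y\<close> are \<open>Q\<close>-integrable.
\<close>

lemma m_is_cond_exp:
  assumes [measurable]: "(\<lambda>(x, \<theta>). g x \<theta>) \<in> borel_measurable (lam \<Otimes>\<^sub>M nu)"
    and mg: "integrable Q (\<lambda>(x, y, \<theta>). m x \<theta> * g x \<theta>)"
    and yg: "integrable Q (\<lambda>(x, y, \<theta>). y * g x \<theta>)"
  shows "(\<integral>(x, y, \<theta>). m x \<theta> * g x \<theta> \<partial>Q) = (\<integral>(x, y, \<theta>). y * g x \<theta> \<partial>Q)"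
proof -
  interpret LV: sigma_finite_measure "lam \<Otimes>\<^sub>M nu"
    by (rule sigma_finite_pair_measure) (rule lam nu)+
  interpret R: pair_sigma_finite "lam \<Otimes>\<^sub>M nu" mu ..
  note rot = distr_pair_rotate[OF lam(1) mu(1) nu(1)]
  have Y: "integrable Q Y_rv" 
    using Y_square_integrable_Q by (rule Q.square_integrable_imp_integrable)
  have dens: "AE w in lam \<Otimes>\<^sub>M mu \<Otimes>\<^sub>M nu. 0 \<le> (case w of (x, y, \<theta>) \<Rightarrow> f x y \<theta> * \<phi> \<theta>)"
    using f_nonneg phi_nonneg by (intro AE_I2) (auto simp: space_pair_measure spaces)
  have rotate: "integrable ((lam \<Otimes>\<^sub>M nu) \<Otimes>\<^sub>M mu) (\<lambda>(q, y). f (fst q) y (snd q) * \<phi> (snd q) * h (fst q, y, snd q)) \<and>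
      (\<integral>w. h w \<partial>Q) = (\<integral>(q, y). f (fst q) y (snd q) * \<phi> (snd q) * h (fst q, y, snd q) \<partial>((lam \<Otimes>\<^sub>M nu) \<Otimes>\<^sub>M mu))"
    if h: "integrable Q h" for h :: "_ \<Rightarrow> real"
  proof -
    have hm[measurable]: "h \<in> borel_measurable (lam \<Otimes>\<^sub>M mu \<Otimes>\<^sub>M nu)"
      using borel_measurable_integrable[OF h] by simp
    let ?k = "\<lambda>(x, y, \<theta>). f x y \<theta> * \<phi> \<theta> * h (x, y, \<theta>)"
    have 1: "integrable (lam \<Otimes>\<^sub>M mu \<Otimes>\<^sub>M nu) ?k" "(\<integral>w. h w \<partial>Q) = (\<integral>w. ?k w \<partial>(lam \<Otimes>\<^sub>M mu \<Otimes>\<^sub>M nu))"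
      using h integrable_density[OF hm _ dens] integral_density[OF hm _ dens]
      by (auto simp: Q_law_def case_prod_beta')
    have 2: "(\<lambda>w. (fst (fst w), snd w, snd (fst w))) \<in> (lam \<Otimes>\<^sub>M nu) \<Otimes>\<^sub>M mu \<rightarrow>\<^sub>M lam \<Otimes>\<^sub>M mu \<Otimes>\<^sub>M nu" by measurable
    have km: "?k \<in> borel_measurable (lam \<Otimes>\<^sub>M mu \<Otimes>\<^sub>M nu)" by measurable
    show ?thesis
      using 1 integrable_distr_eq[OF 2 km] integral_distr[OF 2 km]
      by (simp add: rot case_prod_beta')
  qed
  let ?w = "\<lambda>q y. f (fst q) y (snd q) * \<phi> (snd q)"
  \<comment> \<open>Fubini's theorem, for the integrable functions \<open>1\<close> and \<open>Y\<close>, yields integrable sections.\<close>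
  have one: "AE q in lam \<Otimes>\<^sub>M nu. integrable mu (\<lambda>y. ?w q y * 1)"
    using R.AE_integrable_fst'[OF conjunct1[OF rotate, of "\<lambda>_. 1"]] by simp
  have ly: "AE q in lam \<Otimes>\<^sub>M nu. integrable mu (\<lambda>y. ?w q y * y)"
    using R.AE_integrable_fst'[OF conjunct1[OF rotate[OF Y]]] by simp
  have zero: "AE q in lam \<Otimes>\<^sub>M nu.
      (\<integral>y. ?w q y * (y * g (fst q) (snd q) - m (fst q) (snd q) * g (fst q) (snd q)) \<partial>mu) = 0"
    using one ly AE_space
  proof eventually_elim
    fix q assume 1: "integrable mu (\<lambda>y. ?w q y * 1)" and 2: "integrable mu (\<lambda>y. ?w q y * y)"
      and q: "q \<in> space (lam \<Otimes>\<^sub>M nu)"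
    obtain x \<theta> where [simp]: "q = (x, \<theta>)" by (cases q)
    have [measurable, simp]: "x \<in> space lam" "\<theta> \<in> space nu" using q by (auto simp: space_pair_measure)
    have xF: "x \<in> F" "\<theta> \<in> \<Theta>" using q by (auto simp: space_pair_measure spaces)
    show "(\<integral>y. ?w q y * (y * g (fst q) (snd q) - m (fst q) (snd q) * g (fst q) (snd q)) \<partial>mu) = 0"
    proof (cases "\<phi> \<theta> = 0")
      case False
      have if1: "integrable mu (\<lambda>y. f x y \<theta>)" using 1 False by simp
      have "integrable mu (\<lambda>y. (\<phi> \<theta>) * (y * f x y \<theta>))" using 2 by (simp add: mult_ac)
      then have if2: "integrable mu (\<lambda>y. y * f x y \<theta>)" using False by simp
      have "(\<integral>y. y * f x y \<theta> \<partial>mu) = m x \<theta> * (\<integral>y. f x y \<theta> \<partial>mu)"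
      proof (cases "(\<integral>y. f x y \<theta> \<partial>mu) = 0")
        case True
        then have "AE y in mu. f x y \<theta> = 0"
          using if1 f_nonneg xF
          by (subst (asm) integral_nonneg_eq_0_iff_AE) (auto simp: spaces)
        then have "(\<integral>y. y * f x y \<theta> \<partial>mu) = (\<integral>y. 0 \<partial>mu)"
          by (intro integral_cong_AE) auto
        then show ?thesis using True by simp
      qed (simp add: cond_mean_def)
      moreover have "(\<integral>y. ?w q y * (y * g x \<theta> - m x \<theta> * g x \<theta>) \<partial>mu)
          = (\<integral>y. \<phi> \<theta> * g x \<theta> * (y * f x y \<theta>) - \<phi> \<theta> * g x \<theta> * m x \<theta> * f x y \<theta> \<partial>mu)"
        by (rule Bochner_Integration.integral_cong) (auto simp: algebra_simps)
      ultimately show ?thesis using if1 if2 by simp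
    qed simp
  qed
  let ?h = "\<lambda>(x, y, \<theta>). y * g x \<theta> - m x \<theta> * g x \<theta>"
  have h: "integrable Q ?h"
    using Bochner_Integration.integrable_diff[OF yg mg] by (simp add: case_prod_beta')
  have "(\<integral>w. ?h w \<partial>Q) = (\<integral>q. (\<integral>y. ?w q y * ?h (fst q, y, snd q) \<partial>mu) \<partial>(lam \<Otimes>\<^sub>M nu))"
    using rotate[OF h] R.integral_fst'[OF conjunct1[OF rotate[OF h]]] by (simp add: case_prod_beta')
  also have "\<dots> = (\<integral>q. 0 \<partial>(lam \<Otimes>\<^sub>M nu))"
    using zero by (intro integral_cong_AE) (auto simp: case_prod_beta')
  finally have "(\<integral>w. ?h w \<partial>Q) = 0" by simp
  then show ?thesis
    using Bochner_Integration.integral_diff[OF yg mg] by (simp add: case_prod_beta')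
qed


text \<open>
  Integrability is required of \<open>u g\<close>, not of \<open>m g\<close>: in both directions of the theorem \<open>u\<close> is a known
  square integrable function (\<open>p\<^sub>0(x)\<close>, respectively \<open>A(x) + D(\<theta>)\<close>), from which \<open>m\<close> inherits it.
\<close>

lemma integral_mult_eq_if_eq_cond_mean:
  assumes u: "(\<lambda>(x, \<theta>). u x \<theta>) \<in> borel_measurable (lam \<Otimes>\<^sub>M nu)"
    and g: "(\<lambda>(x, \<theta>). g x \<theta>) \<in> borel_measurable (lam \<Otimes>\<^sub>M nu)"
    and eq: "AE (x, y, \<theta>) in Q. u x \<theta> = m x \<theta>"
    and ug: "integrable Q (\<lambda>(x, y, \<theta>). u x \<theta> * g x \<theta>)"
    and yg: "integrable Q (\<lambda>(x, y, \<theta>). y * g x \<theta>)"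
  shows "(\<integral>(x, y, \<theta>). u x \<theta> * g x \<theta> \<partial>Q) = (\<integral>(x, y, \<theta>). y * g x \<theta> \<partial>Q)"
proof -
  have lift: "(\<lambda>(x, y, \<theta>). h x \<theta>) \<in> borel_measurable Q"
    if "(\<lambda>(x, \<theta>). h x \<theta>) \<in> borel_measurable (lam \<Otimes>\<^sub>M nu)" for h :: "'a \<Rightarrow> real \<Rightarrow> real"
  proof -
    have "(\<lambda>(x, y, \<theta>). (x, \<theta>)) \<in> measurable Q (lam \<Otimes>\<^sub>M nu)" by measurable
    from measurable_compose[OF this that] show ?thesis by (simp add: case_prod_beta')
  qed
  have ugm: "(\<lambda>(x, y, \<theta>). u x \<theta> * g x \<theta>) \<in> borel_measurable Q"
    using ug by (rule borel_measurable_integrable)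
  have mgm: "(\<lambda>(x, y, \<theta>). m x \<theta> * g x \<theta>) \<in> borel_measurable Q"
    using borel_measurable_times[OF lift[OF m_measurable] lift[OF g]]
    by (simp add: case_prod_beta')
  have ae: "AE w in Q. (case w of (x, y, \<theta>) \<Rightarrow> u x \<theta> * g x \<theta>) = (case w of (x, y, \<theta>) \<Rightarrow> m x \<theta> * g x \<theta>)"
    using eq by eventually_elim auto
  have "integrable Q (\<lambda>(x, y, \<theta>). m x \<theta> * g x \<theta>)"
    using integrable_cong_AE[OF ugm mgm ae] ug by simp
  with m_is_cond_exp[OF g _ yg] integral_cong_AE[OF ugm mgm ae] show ?thesis by simp
qed

section \<open>The Bayesian predictor as an orthogonal projection\<close>

text \<open>
  Comparison with the predictor \<open>0\<close>, whose risk \<open>E Y\<^sup>2\<close> is finite, shows that \<open>p\<^sub>0(X) - Y\<close> is square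
  integrable.
\<close>

lemma square_integrable_bayesian_predictor:
  assumes "bayesian_predictor lam mu nu f \<phi> p0"
  shows "square_integrable Q (\<lambda>w. p0 (X_rv w))"
proof -
  have p0[measurable]: "p0 \<in> borel_measurable lam"
    and min: "\<And>p. p \<in> borel_measurable lam \<Longrightarrow>
      (\<integral>\<^sup>+(x, y, \<theta>). ennreal ((p0 x - y)\<^sup>2) \<partial>Q) \<le> (\<integral>\<^sup>+(x, y, \<theta>). ennreal ((p x - y)\<^sup>2) \<partial>Q)"
    using assms by (auto simp: bayesian_predictor_def is_arg_min_linorder)
  have "(\<integral>\<^sup>+w. ennreal ((Y_rv w)\<^sup>2) \<partial>Q) < \<infinity>"
    using Y_square_integrable_Q by (simp add: square_integrable_def integrable_iff_bounded)
  then have "(\<integral>\<^sup>+w. ennreal ((p0 (X_rv w) - Y_rv w)\<^sup>2) \<partial>Q) < \<infinity>"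
    using min[of "\<lambda>_. 0"] by (simp add: case_prod_beta')
  then have "integrable Q (\<lambda>w. (p0 (X_rv w) - Y_rv w)\<^sup>2)"
    by (intro integrableI_nonneg) auto
  then have "square_integrable Q (\<lambda>w. p0 (X_rv w) - Y_rv w)"
    by (simp add: square_integrable_def)
  from square_integrable_add[OF this Y_square_integrable_Q] show ?thesis by simp
qed

text \<open>
  Every \<open>p\<^sub>0 + t g\<close> is a competitor of \<open>p\<^sub>0\<close>, so the residual \<open>p\<^sub>0(X) - Y\<close> is orthogonal to \<open>g(X)\<close>.
\<close>

lemma bayesian_predictor_orthogonal:
  assumes bayes: "bayesian_predictor lam mu nu f \<phi> p0"
    and g[measurable]: "g \<in> borel_measurable lam" and gi: "square_integrable Q (\<lambda>w. g (X_rv w))"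
  shows "(\<integral>w. p0 (X_rv w) * g (X_rv w) \<partial>Q) = (\<integral>w. Y_rv w * g (X_rv w) \<partial>Q)"
proof -
  have p0[measurable]: "p0 \<in> borel_measurable lam"
    and min: "\<And>p. p \<in> borel_measurable lam \<Longrightarrow>
      (\<integral>\<^sup>+(x, y, \<theta>). ennreal ((p0 x - y)\<^sup>2) \<partial>Q) \<le> (\<integral>\<^sup>+(x, y, \<theta>). ennreal ((p x - y)\<^sup>2) \<partial>Q)"
    using bayes by (auto simp: bayesian_predictor_def is_arg_min_linorder)
  note p0i = square_integrable_bayesian_predictor[OF bayes]
  let ?r = "\<lambda>w. p0 (X_rv w) - Y_rv w"
  have r: "square_integrable Q ?r"
    by (rule square_integrable_diff[OF p0i Y_square_integrable_Q])
  have "(\<integral>w. ?r w * g (X_rv w) \<partial>Q) = 0"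
  proof (rule least_squares_orthogonal[OF r gi])
    fix t
    have rt: "square_integrable Q (\<lambda>w. ?r w + t * g (X_rv w))"
      by (rule square_integrable_add[OF r square_integrable_cmult[OF gi]])
    have "ennreal (\<integral>w. (?r w)\<^sup>2 \<partial>Q) = (\<integral>\<^sup>+w. ennreal ((?r w)\<^sup>2) \<partial>Q)"
      using r by (subst nn_integral_eq_integral) (auto simp: square_integrable_def)
    also have "\<dots> \<le> (\<integral>\<^sup>+w. ennreal ((?r w + t * g (X_rv w))\<^sup>2) \<partial>Q)"
      using min[of "\<lambda>x. p0 x + t * g x"] by (simp add: case_prod_beta' algebra_simps)
    also have "\<dots> = ennreal (\<integral>w. (?r w + t * g (X_rv w))\<^sup>2 \<partial>Q)"
      using rt by (subst nn_integral_eq_integral) (auto simp: square_integrable_def)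
    finally show "(\<integral>w. (?r w)\<^sup>2 \<partial>Q) \<le> (\<integral>w. (?r w + t * g (X_rv w))\<^sup>2 \<partial>Q)"
      by (subst (asm) ennreal_le_iff) auto
  qed
  moreover have "(\<integral>w. ?r w * g (X_rv w) \<partial>Q)
      = (\<integral>w. p0 (X_rv w) * g (X_rv w) \<partial>Q) - (\<integral>w. Y_rv w * g (X_rv w) \<partial>Q)"
    using square_integrable_imp_integrable_mult[OF p0i gi]
      square_integrable_imp_integrable_mult[OF Y_square_integrable_Q gi]
    by (simp add: left_diff_distrib)
  ultimately show ?thesis by simp
qed

section \<open>Unbiasedness as equality of inner products\<close>

abbreviation "sigma_T \<equiv> vimage_algebra (space Q) T_rv nu"

lemma subalgebra_T: "subalgebra Q sigma_T"
proof -
  have "T_rv \<in> measurable Q nu" by measurable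
  then show ?thesis
    unfolding subalgebra_def using sets_image_in_sets[OF refl, of T_rv Q nu] by simp
qed

sublocale T: finite_measure_subalgebra Q sigma_T
  by unfold_locales (rule subalgebra_T)

lemma T_measurable: "T_rv \<in> measurable sigma_T nu"
  by (rule measurable_vimage_algebra1) (auto simp: space_Q spaces)

text \<open>
  A function of \<open>T\<close> can be moved in and out of a conditional expectation given \<open>T\<close>, so \<open>p(X)\<close> and
  \<open>Y\<close> may be replaced by their conditional expectations, which agree.
\<close>

lemma unbiased_integral_eq:
  assumes unb: "unbiased_predictor lam mu nu f \<phi> p" and pi: "square_integrable Q (\<lambda>w. p (X_rv w))"
    and D: "D \<in> borel_measurable nu" and Di: "square_integrable Q (\<lambda>w. D (T_rv w))"
  shows "(\<integral>w. p (X_rv w) * D (T_rv w) \<partial>Q) = (\<integral>w. Y_rv w * D (T_rv w) \<partial>Q)"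
proof -
  have D': "(\<lambda>w. D (T_rv w)) \<in> borel_measurable sigma_T"
    by (rule measurable_compose[OF T_measurable D])
  have eq: "AE w in Q. real_cond_exp Q sigma_T (\<lambda>w. p (X_rv w)) w = real_cond_exp Q sigma_T Y_rv w"
    using unb by (simp add: unbiased_predictor_def Let_def)
  have ce: "(\<integral>w. D (T_rv w) * real_cond_exp Q sigma_T u w \<partial>Q) = (\<integral>w. D (T_rv w) * u w \<partial>Q)"
    if u: "square_integrable Q u" for u
    using u D' square_integrable_imp_integrable_mult[OF Di u]
    by (intro T.real_cond_exp_intg) (auto simp: square_integrable_def)
  have [measurable]: "(\<lambda>w. D (T_rv w)) \<in> borel_measurable Q"
    using Di by (simp add: square_integrable_def)
  have "(\<integral>w. D (T_rv w) * p (X_rv w) \<partial>Q)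
      = (\<integral>w. D (T_rv w) * real_cond_exp Q sigma_T (\<lambda>w. p (X_rv w)) w \<partial>Q)"
    using ce[OF pi] by simp
  also have "\<dots> = (\<integral>w. D (T_rv w) * real_cond_exp Q sigma_T Y_rv w \<partial>Q)"
  proof (rule integral_cong_AE)
    show "(\<lambda>w. D (T_rv w) * real_cond_exp Q sigma_T u w) \<in> borel_measurable Q" for u
      by (intro borel_measurable_times borel_measurable_cond_exp2) fact
    then show "(\<lambda>w. D (T_rv w) * real_cond_exp Q sigma_T Y_rv w) \<in> borel_measurable Q" .
  qed (use eq in \<open>auto elim!: eventually_mono\<close>)
  also have "\<dots> = (\<integral>w. D (T_rv w) * Y_rv w \<partial>Q)"
    by (rule ce[OF Y_square_integrable_Q])
  finally show ?thesis by (simp add: mult.commute)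
qed

text \<open>
  The events generated by \<open>T\<close> are exactly the \<open>{T \<in> B}\<close>, so the hypothesis is the defining property
  of \<open>E(Y | T)\<close> as a version of \<open>E(p(X) | T)\<close>.
\<close>

lemma unbiased_of_set_integrals:
  assumes p[measurable]: "p \<in> borel_measurable lam" and pi: "integrable Q (\<lambda>w. p (X_rv w))"
    and B: "\<And>B. B \<in> sets nu \<Longrightarrow>
      (\<integral>w. p (X_rv w) * indicator B (T_rv w) \<partial>Q) = (\<integral>w. Y_rv w * indicator B (T_rv w) \<partial>Q)"
  shows "unbiased_predictor lam mu nu f \<phi> p"
proof -
  have Y: "integrable Q Y_rv"
    by (rule Q.square_integrable_imp_integrable[OF Y_square_integrable_Q])
  have "AE w in Q. real_cond_exp Q sigma_T (\<lambda>w. p (X_rv w)) w = real_cond_exp Q sigma_T Y_rv w"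
  proof (rule T.real_cond_exp_charact)
    fix S assume S: "S \<in> sets sigma_T"
    have "T_rv \<in> space Q \<rightarrow> space nu" by (auto simp: space_Q spaces)
    then obtain B where B': "B \<in> sets nu" and SB: "S = T_rv -` B \<inter> space Q"
      using S by (auto simp: sets_vimage_algebra2)
    have ind: "(\<integral>w\<in>S. u w \<partial>Q) = (\<integral>w. u w * indicator B (T_rv w) \<partial>Q)" for u :: "_ \<Rightarrow> real"
      unfolding set_lebesgue_integral_def SB
      by (rule Bochner_Integration.integral_cong) (auto simp: indicator_def)
    show "(\<integral>w\<in>S. p (X_rv w) \<partial>Q) = (\<integral>w\<in>S. real_cond_exp Q sigma_T Y_rv w \<partial>Q)"
      using B[OF B'] T.real_cond_exp_intA[OF Y S] ind[of "\<lambda>w. p (X_rv w)"] ind[of Y_rv] by simp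
  qed (rule pi T.real_cond_exp_int(1)[OF Y] borel_measurable_cond_exp)+
  then show ?thesis using p pi by (simp add: unbiased_predictor_def Let_def)
qed

section \<open>Unbiasedness and equality with the regression function\<close>

lemma mean_square_zero_iff:
  assumes [measurable]: "p \<in> borel_measurable lam"
  shows "(\<integral>\<^sup>+(x, y, \<theta>). ennreal ((p x - m x \<theta>)\<^sup>2) \<partial>Q) = 0 \<longleftrightarrow> (AE (x, y, \<theta>) in Q. p x = m x \<theta>)"
proof -
  have "(\<lambda>w. ennreal ((p (X_rv w) - m (X_rv w) (T_rv w))\<^sup>2)) \<in> borel_measurable Q"
    by measurable
  then show ?thesis
    by (simp add: nn_integral_0_iff_AE case_prod_beta')
qed

lemma unbiased_if_eq_cond_mean:
  assumes bayes: "bayesian_predictor lam mu nu f \<phi> p0"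
    and eq: "AE (x, y, \<theta>) in Q. p0 x = m x \<theta>"
  shows "unbiased_predictor lam mu nu f \<phi> p0"
proof (rule unbiased_of_set_integrals)
  show p0[measurable]: "p0 \<in> borel_measurable lam"
    using bayes by (auto simp: bayesian_predictor_def is_arg_min_def)
  show pi: "integrable Q (\<lambda>w. p0 (X_rv w))"
    by (rule Q.square_integrable_imp_integrable[OF square_integrable_bayesian_predictor[OF bayes]])
  fix B assume B[measurable]: "B \<in> sets nu"
  have Y: "integrable Q Y_rv"
    by (rule Q.square_integrable_imp_integrable[OF Y_square_integrable_Q])
  have bnd: "integrable Q (\<lambda>w. u w * (indicator B (T_rv w) :: real))" if u: "integrable Q u" for u
  proof (rule Bochner_Integration.integrable_bound[OF u])
    note [measurable] = borel_measurable_integrable[OF u]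
    have [measurable]: "T_rv \<in> measurable Q nu" by measurable
    show "(\<lambda>w. u w * (indicator B (T_rv w) :: real)) \<in> borel_measurable Q" by measurable
  qed (auto simp: indicator_def)
  have "(\<integral>(x, y, \<theta>). p0 x * indicator B \<theta> \<partial>Q) = (\<integral>(x, y, \<theta>). y * indicator B \<theta> \<partial>Q)"
  proof (rule integral_mult_eq_if_eq_cond_mean[OF _ _ eq])
    show "integrable Q (\<lambda>(x, y, \<theta>). p0 x * indicator B \<theta>)"
      using bnd[OF pi] by (simp add: case_prod_beta')
    show "integrable Q (\<lambda>(x, y, \<theta>). y * indicator B \<theta>)"
      using bnd[OF Y] by (simp add: case_prod_beta')
  qed measurable
  then show "(\<integral>w. p0 (X_rv w) * indicator B (T_rv w) \<partial>Q) = (\<integral>w. Y_rv w * indicator B (T_rv w) \<partial>Q)"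
    by (simp add: case_prod_beta')
qed

text \<open>
  With \<open>B = p\<^sub>0 - A\<close>, optimality of \<open>p\<^sub>0\<close> is tested against \<open>B(X)\<close> and unbiasedness against \<open>D(T)\<close>.
  Both tests produce the same mixed term \<open>E B(X) D(T)\<close>, which forces \<open>B(X) = D(T)\<close>.
\<close>

lemma eq_cond_mean_if_unbiased:
  assumes bayes: "bayesian_predictor lam mu nu f \<phi> p0"
    and unb: "unbiased_predictor lam mu nu f \<phi> p0"
    and add: "\<And>\<theta>. \<theta> \<in> \<Theta> \<Longrightarrow> AE (x, y) in P_law lam mu f \<theta>. m x \<theta> = A x + D \<theta>"
    and A: "square_integrable (Q_XT_law lam mu nu f \<phi>) (\<lambda>(x, \<theta>). A x)"
    and D: "square_integrable (Q_XT_law lam mu nu f \<phi>) (\<lambda>(x, \<theta>). D \<theta>)"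
  shows "AE (x, y, \<theta>) in Q. p0 x = m x \<theta>"
proof -
  have p0[measurable]: "p0 \<in> borel_measurable lam"
    using bayes by (auto simp: bayesian_predictor_def is_arg_min_def)
  note p0i = square_integrable_bayesian_predictor[OF bayes]
  have proj: "(\<lambda>(x, y, \<theta>). (x, \<theta>)) \<in> measurable Q (lam \<Otimes>\<^sub>M nu)" by measurable
  have pull: "square_integrable Q (\<lambda>w. h (X_rv w, T_rv w))"
    if "square_integrable (Q_XT_law lam mu nu f \<phi>) h" for h
  proof -
    have [measurable]: "h \<in> borel_measurable (lam \<Otimes>\<^sub>M nu)"
      using that by (simp add: square_integrable_def Q_XT_law_def)
    show ?thesis
      using that integrable_distr_eq[OF proj, of "\<lambda>z. (h z)\<^sup>2"]
      by (simp add: square_integrable_def Q_XT_law_def case_prod_beta')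
  qed
  have Ai: "square_integrable Q (\<lambda>w. A (X_rv w))" and Di: "square_integrable Q (\<lambda>w. D (T_rv w))"
    using pull[OF A] pull[OF D] by simp_all
  have A2: "(\<lambda>(x, \<theta>). A x) \<in> borel_measurable (lam \<Otimes>\<^sub>M nu)"
    and D2: "(\<lambda>(x, \<theta>). D \<theta>) \<in> borel_measurable (lam \<Otimes>\<^sub>M nu)"
    using A D by (simp_all add: square_integrable_def Q_XT_law_def)
  \<comment> \<open>A function of one coordinate that is measurable on the product is measurable on its factor,
    because the other factor has a point to fix.\<close>
  obtain x0 \<theta>0 where x0: "x0 \<in> space lam" and \<theta>0: "\<theta>0 \<in> space nu"
    using Q.not_empty by (auto simp: space_Q spaces)
  have Am[measurable]: "A \<in> borel_measurable lam"
    using measurable_compose[OF measurable_Pair2'[OF \<theta>0] A2] by simp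
  have Dm[measurable]: "D \<in> borel_measurable nu"
    using measurable_compose[OF measurable_Pair1'[OF x0] D2] by simp
  have meq: "AE w in Q. m (X_rv w) (T_rv w) = A (X_rv w) + D (T_rv w)"
  proof (rule AE_Q_of_AE_P)
    show "AE (x, y) in P_law lam mu f \<theta>. m (X_rv (x, y, \<theta>)) (T_rv (x, y, \<theta>))
        = A (X_rv (x, y, \<theta>)) + D (T_rv (x, y, \<theta>))" if "\<theta> \<in> \<Theta>" for \<theta>
      using add[OF that] by simp
  qed measurable
  define B where "B x = p0 x - A x" for x
  have Bm[measurable]: "B \<in> borel_measurable lam" unfolding B_def by measurable
  have Bi: "square_integrable Q (\<lambda>w. B (X_rv w))"
    unfolding B_def by (rule square_integrable_diff[OF p0i Ai])
  have Yh: "(\<integral>w. Y_rv w * h (X_rv w) (T_rv w) \<partial>Q)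
      = (\<integral>w. A (X_rv w) * h (X_rv w) (T_rv w) \<partial>Q) + (\<integral>w. D (T_rv w) * h (X_rv w) (T_rv w) \<partial>Q)"
    if hm[measurable]: "(\<lambda>(x, \<theta>). h x \<theta>) \<in> borel_measurable (lam \<Otimes>\<^sub>M nu)"
      and h: "square_integrable Q (\<lambda>w. h (X_rv w) (T_rv w))" for h
  proof -
    note Ah = square_integrable_imp_integrable_mult[OF Ai h]
      and Dh = square_integrable_imp_integrable_mult[OF Di h]
      and yh = square_integrable_imp_integrable_mult[OF Y_square_integrable_Q h]
    have "(\<integral>(x, y, \<theta>). (A x + D \<theta>) * h x \<theta> \<partial>Q) = (\<integral>(x, y, \<theta>). y * h x \<theta> \<partial>Q)"
    proof (rule integral_mult_eq_if_eq_cond_mean[OF _ hm])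
      show "AE (x, y, \<theta>) in Q. A x + D \<theta> = m x \<theta>"
        using meq by eventually_elim auto
      show "integrable Q (\<lambda>(x, y, \<theta>). (A x + D \<theta>) * h x \<theta>)"
        using Bochner_Integration.integrable_add[OF Ah Dh] by (simp add: case_prod_beta' distrib_right)
      show "integrable Q (\<lambda>(x, y, \<theta>). y * h x \<theta>)"
        using yh by (simp add: case_prod_beta')
    qed measurable
    then show ?thesis
      using Bochner_Integration.integral_add[OF Ah Dh] by (simp add: case_prod_beta' distrib_right)
  qed
  have "AE w in Q. B (X_rv w) = D (T_rv w)"
  proof (rule AE_eq_of_norms_eq_inner[OF Bi Di])
    have "(\<integral>w. p0 (X_rv w) * B (X_rv w) \<partial>Q)
       = (\<integral>w. A (X_rv w) * B (X_rv w) \<partial>Q) + (\<integral>w. D (T_rv w) * B (X_rv w) \<partial>Q)"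
      using bayesian_predictor_orthogonal[OF bayes Bm Bi] Yh[of "\<lambda>x \<theta>. B x"] Bi by simp
    moreover have "(\<integral>w. p0 (X_rv w) * B (X_rv w) \<partial>Q)
       = (\<integral>w. A (X_rv w) * B (X_rv w) + (B (X_rv w))\<^sup>2 \<partial>Q)"
      by (simp add: B_def power2_eq_square algebra_simps)
    ultimately show "(\<integral>w. (B (X_rv w))\<^sup>2 \<partial>Q) = (\<integral>w. B (X_rv w) * D (T_rv w) \<partial>Q)"
      using square_integrable_imp_integrable_mult[OF Ai Bi] Bi
      by (simp add: square_integrable_def mult.commute)
    have "(\<integral>w. p0 (X_rv w) * D (T_rv w) \<partial>Q)
       = (\<integral>w. A (X_rv w) * D (T_rv w) \<partial>Q) + (\<integral>w. (D (T_rv w))\<^sup>2 \<partial>Q)"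
      using unbiased_integral_eq[OF unb p0i Dm Di] Yh[of "\<lambda>x \<theta>. D \<theta>"] Di
      by (simp add: power2_eq_square)
    moreover have "(\<integral>w. p0 (X_rv w) * D (T_rv w) \<partial>Q)
       = (\<integral>w. A (X_rv w) * D (T_rv w) + B (X_rv w) * D (T_rv w) \<partial>Q)"
      by (simp add: B_def algebra_simps)
    ultimately show "(\<integral>w. (D (T_rv w))\<^sup>2 \<partial>Q) = (\<integral>w. B (X_rv w) * D (T_rv w) \<partial>Q)"
      using square_integrable_imp_integrable_mult[OF Ai Di] square_integrable_imp_integrable_mult[OF Bi Di]
      by simp
  qed
  with meq show ?thesis
    by eventually_elim (auto simp: B_def)
qed

end

theorem proposition4p4:
  fixes F :: "'a::euclidean_space set" and G \<Theta> :: "real set"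
    and lam :: "'a measure" and mu nu :: "real measure"
    and f :: "'a \<Rightarrow> real \<Rightarrow> real \<Rightarrow> real" and \<phi> :: "real \<Rightarrow> real" and p0 :: "'a \<Rightarrow> real"
  assumes "bayesian_prediction_model F G \<Theta> lam mu nu f \<phi>"
    and "bayesian_predictor lam mu nu f \<phi> p0"
  shows
    "((\<integral>\<^sup>+(x, y, \<theta>). ennreal ((p0 x - cond_mean mu f x \<theta>)\<^sup>2) \<partial>Q_law lam mu nu f \<phi>) = 0
        \<longrightarrow> unbiased_predictor lam mu nu f \<phi> p0)
     \<and>
     (\<forall>(A :: 'a \<Rightarrow> real) (D :: real \<Rightarrow> real).
        (\<forall>x\<in>F. \<forall>y\<in>G. \<forall>\<theta>\<in>\<Theta>. 0 < f x y \<theta> * \<phi> \<theta>) \<and>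
        (\<forall>x\<in>F. \<forall>y\<in>G. continuous_on \<Theta> (\<lambda>\<theta>. f x y \<theta>)) \<and>
        continuous_on \<Theta> \<phi> \<and>
        (\<forall>\<theta>\<in>\<Theta>. AE (x, y) in P_law lam mu f \<theta>. cond_mean mu f x \<theta> = A x + D \<theta>) \<and>
        square_integrable (Q_XT_law lam mu nu f \<phi>) (\<lambda>(x, \<theta>). A x) \<and>
        square_integrable (Q_XT_law lam mu nu f \<phi>) (\<lambda>(x, \<theta>). D \<theta>) \<and>
        unbiased_predictor lam mu nu f \<phi> p0
        \<longrightarrow> (\<integral>\<^sup>+(x, y, \<theta>). ennreal ((p0 x - cond_mean mu f x \<theta>)\<^sup>2) \<partial>Q_law lam mu nu f \<phi>) = 0)"
proof -
  interpret bayesian_prediction_model F G \<Theta> lam mu nu f \<phi> by fact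
  have p0: "p0 \<in> borel_measurable lam"
    using assms(2) by (auto simp: bayesian_predictor_def is_arg_min_def)
  show ?thesis
    unfolding mean_square_zero_iff[OF p0]
  proof (intro conjI impI allI)
    assume "AE (x, y, \<theta>) in Q. p0 x = m x \<theta>"
    then show "unbiased_predictor lam mu nu f \<phi> p0"
      by (rule unbiased_if_eq_cond_mean[OF assms(2)])
  qed (elim conjE, rule eq_cond_mean_if_unbiased[OF assms(2)], simp_all)
qed

end
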